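(* Let $(\mathbb U,\mathbb Y)$ be time-domain input-output data generated by a minimal order $n$ discrete-time SISO linear system $\mathcal S$ with transfer function $H(z)$, and let $\mathbf G_n$, $\mathbf z(\sigma)$, $\mathbf b(\sigma)$ be as defined in the context. Assume that for $\sigma\in\mathbb C$ the rank conditions $$\operatorname{rank}\begin{bmatrix}\mathbb H_n(\mathbb U)&0&\gamma_n(\sigma)\\ \mathbb H_n(\mathbb Y)&\gamma_n(\sigma)&0\end{bmatrix}=\operatorname{rank}\begin{bmatrix}\mathbb H_n(\mathbb U)&0\\ \mathbb H_n(\mathbb Y)&\gamma_n(\sigma)\end{bmatrix}$$ and $$\operatorname{rank}\begin{bmatrix}\mathbb H_n(\mathbb U)&0\\ \mathbb H_n(\mathbb Y)&\gamma_n(\sigma)\end{bmatrix}=\operatorname{rank}\begin{bmatrix}\mathbb H_n(\mathbb U)\\ \mathbb H_n(\mathbb Y)\end{bmatrix}+1$$ are satisfied. Let $\mathbf G_n=\mathbf U\Sigma\mathbf V^*$ be the thin SVD of $\mathbf G_n$, where, for some $p\le T-n+1$, $\mathbf U\in\mathbb R^{2(n+1)\times p}$ and $\mathbf V\in\mathbb R^{(T-n+1)\times p}$ have orthonormal columns and $\Sigma\in\mathbb R^{p\times p}$ is diagonal with strictly positive diagonal entries. Then there exist $\xi\in\mathbb C^{T-n+1}$ and $\hat\xi\in\mathbb C^{p}$ such that $$\begin{bmatrix}\mathbf G_n&\mathbf z(\sigma)\end{bmatrix}\begin{bmatrix}\xi\\ H(\sigma)\end{bmatrix}=\mathbf b(\sigma)\quad\text{and}\quad\begin{bmatrix}\mathbf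 U&\mathbf z(\sigma)\end{bmatrix}\begin{bmatrix}\hat\xi\\ H(\sigma)\end{bmatrix}=\mathbf b(\sigma).$$ Therefore, the last component of any solution $\mathbf x\in\mathbb C^{T-n+2}$ of $[\mathbf G_n\ \mathbf z(\sigma)]\mathbf x=\mathbf b(\sigma)$, and of any solution $\hat{\mathbf x}\in\mathbb C^{p+1}$ of $[\mathbf U\ \mathbf z(\sigma)]\hat{\mathbf x}=\mathbf b(\sigma)$, is $H(\sigma)$.
   Context: System: $\mathcal S$ is $\mathbf x[k+1]=\mathbf A\mathbf x[k]+\mathbf b u[k]$, $y[k]=\mathbf c^\top\mathbf x[k]$ with $\mathbf A\in\mathbb R^{n\times n}$, $\mathbf b,\mathbf c\in\mathbb R^n$, minimal (controllable and observable), with arbitrary initial state. Equivalently, its input/output behavior is described by a difference equation $$y[t+n]+p_{n-1}y[t+n-1]+\cdots+p_0y[t]=q_nu[t+n]+q_{n-1}u[t+n-1]+\cdots+q_0u[t]$$ with real coefficients. Its transfer function is $$H(z)=\mathbf c^\top(z\mathbf I-\mathbf A)^{-1}\mathbf b=\frac{Q(z)}{P(z)},\quad P(z)=z^n+p_{n-1}z^{n-1}+\cdots+p_0,\quad Q(z)=q_nz^n+\cdots+q_0,$$ and by minimality $P$ and $Q$ are coprime. Data: $\mathbb U=[u[0],\dots,u[T]]^\top\in\mathbb R^{T+1}$ and $\mathbb Y=[y[0],\dots,y[T]]^\top\in\mathbb R^{T+1}$, with $T\ge n$, are an input sequence and the corresponding output sequence of $\mathcal S$. Hankel matrix of depth $n$: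 $\mathbb H_n(\mathbb U)\in\mathbb R^{(n+1)\times(T-n+1)}$ has $(i,j)$ entry $u[i+j]$ for $0\le i\le n$, $0\le j\le T-n$; similarly $\mathbb H_n(\mathbb Y)$. Notation: $\gamma_n(\sigma)=[1,\sigma,\sigma^2,\dots,\sigma^n]^\top\in\mathbb C^{n+1}$; $$\mathbf G_n=\begin{bmatrix}\mathbb H_n(\mathbb U)\\ \mathbb H_n(\mathbb Y)\end{bmatrix},\quad \mathbf z(\sigma)=\begin{bmatrix}\mathbf 0\\ -\gamma_n(\sigma)\end{bmatrix},\quad \mathbf b(\sigma)=\begin{bmatrix}\gamma_n(\sigma)\\ \mathbf 0\end{bmatrix}\in\mathbb C^{2(n+1)}.$$ (The vector $\mathbf b(\sigma)$ is unrelated to the input vector $\mathbf b$ of the system.) *)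

theory Defs
  imports "Jordan_Normal_Form.Gauss_Jordan_Elimination" "Jordan_Normal_Form.DL_Rank"
    Complex_Main
begin

fun state :: "real mat \<Rightarrow> real vec \<Rightarrow> (nat \<Rightarrow> real) \<Rightarrow> real vec \<Rightarrow> nat \<Rightarrow> real vec" where
  "state A b u x0 0 = x0"
| "state A b u x0 (Suc k) = A *\<^sub>v state A b u x0 k + u k \<cdot>\<^sub>v b"

definition sys_output ::
  "real mat \<Rightarrow> real vec \<Rightarrow> real vec \<Rightarrow> (nat \<Rightarrow> real) \<Rightarrow> real vec \<Rightarrow> nat \<Rightarrow> real" where
  "sys_output A b c u x0 k = c \<bullet> state A b u x0 k"

definition controllable :: "nat \<Rightarrow> real mat \<Rightarrow> real vec \<Rightarrow> bool" where
  "controllable n A b \<longleftrightarrow>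
     (\<forall>x0\<in>carrier_vec n. \<forall>x1\<in>carrier_vec n. \<exists>u N. state A b u x0 N = x1)"

definition observable :: "nat \<Rightarrow> real mat \<Rightarrow> real vec \<Rightarrow> real vec \<Rightarrow> bool" where
  "observable n A b c \<longleftrightarrow>
     (\<exists>N. \<forall>u. \<forall>x0\<in>carrier_vec n. \<forall>x1\<in>carrier_vec n.
        (\<forall>k<N. sys_output A b c u x0 k = sys_output A b c u x1 k) \<longrightarrow> x0 = x1)"

definition minimal_system :: "nat \<Rightarrow> real mat \<Rightarrow> real vec \<Rightarrow> real vec \<Rightarrow> bool" where
  "minimal_system n A b c \<longleftrightarrow>
     A \<in> carrier_mat n n \<and> b \<in> carrier_vec n \<and> c \<in> carrier_vec n \<and>
     controllable n A b \<and> observable n A b c"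

text \<open>\<open>U\<close> and \<open>Y\<close> hold the samples at times \<open>0, \<dots>, T\<close>, where \<open>T + 1\<close> is their common dimension.
  The outputs up to time \<open>T\<close> do not depend on values \<open>U $ k\<close> with \<open>k\<close> out of range.\<close>

definition io_data ::
  "nat \<Rightarrow> real mat \<Rightarrow> real vec \<Rightarrow> real vec \<Rightarrow> real vec \<Rightarrow> real vec \<Rightarrow> bool" where
  "io_data n A b c U Y \<longleftrightarrow> dim_vec Y = dim_vec U \<and>
     (\<exists>x0\<in>carrier_vec n. \<forall>k<dim_vec U. Y $ k = sys_output A b c (\<lambda>i. U $ i) x0 k)"

definition zI_minus :: "real mat \<Rightarrow> complex \<Rightarrow> complex mat" where
  "zI_minus A z = z \<cdot>\<^sub>m 1\<^sub>m (dim_row A) - map_mat complex_of_real A"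

text \<open>The value is meaningful only where \<open>zI_minus A z\<close> is invertible;
  otherwise \<open>mat_inverse\<close> returns \<open>None\<close> and the value is unspecified.\<close>

definition transfer_fun :: "real mat \<Rightarrow> real vec \<Rightarrow> real vec \<Rightarrow> complex \<Rightarrow> complex" where
  "transfer_fun A b c z =
     map_vec complex_of_real c \<bullet>
       (the (mat_inverse (zI_minus A z)) *\<^sub>v map_vec complex_of_real b)"

text \<open>For \<open>w\<close> of dimension \<open>T + 1\<close> with \<open>n \<le> T\<close>, the number of columns is \<open>T - n + 1\<close>.\<close>

definition hankel :: "nat \<Rightarrow> real vec \<Rightarrow> real mat" where
  "hankel n w = mat (n + 1) (dim_vec w - n) (\<lambda>(i, j). w $ (i + j))"

definition data_mat :: "nat \<Rightarrow> real vec \<Rightarrow> real vec \<Rightarrow> real mat" where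
  "data_mat n U Y = hankel n U @\<^sub>r hankel n Y"

definition gamma_vec :: "nat \<Rightarrow> complex \<Rightarrow> complex vec" where
  "gamma_vec n \<sigma> = vec (n + 1) (\<lambda>i. \<sigma> ^ i)"

definition z_vec :: "nat \<Rightarrow> complex \<Rightarrow> complex vec" where
  "z_vec n \<sigma> = 0\<^sub>v (n + 1) @\<^sub>v (- gamma_vec n \<sigma>)"

definition b_vec :: "nat \<Rightarrow> complex \<Rightarrow> complex vec" where
  "b_vec n \<sigma> = gamma_vec n \<sigma> @\<^sub>v 0\<^sub>v (n + 1)"

definition append_col :: "'a mat \<Rightarrow> 'a vec \<Rightarrow> 'a mat" where
  "append_col M v = mat_of_cols (dim_row M) (cols M @ [v])"

abbreviation mat_rank :: "complex mat \<Rightarrow> nat" where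
  "mat_rank M \<equiv> vec_space.rank (dim_row M) M"

text \<open>Thin singular value decomposition \<open>G = W * S * V\<^sup>T\<close> of a real matrix with \<open>p\<close> (positive)
  singular values, not necessarily listed in decreasing order. All factors are real, so the
  conjugate transpose of \<open>V\<close> is its transpose.\<close>

definition thin_svd :: "real mat \<Rightarrow> nat \<Rightarrow> real mat \<Rightarrow> real mat \<Rightarrow> real mat \<Rightarrow> bool" where
  "thin_svd G p W S V \<longleftrightarrow>
     W \<in> carrier_mat (dim_row G) p \<and> S \<in> carrier_mat p p \<and> V \<in> carrier_mat (dim_col G) p \<and>
     W\<^sup>T * W = 1\<^sub>m p \<and> V\<^sup>T * V = 1\<^sub>m p \<and>
     diagonal_mat S \<and> (\<forall>i<p. S $$ (i, i) > 0) \<and>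
     G = W * S * V\<^sup>T"

end

theory Submission
  imports Defs
begin

text \<open>Let \<open>G \<xi> + h z(\<sigma>) = b(\<sigma>)\<close>. Combining the shifted state trajectories of the data with the weights
  \<open>\<xi>\<close> gives states \<open>\<chi>\<^sub>i\<close>, \<open>0 \<le> i \<le> n + 1\<close>, driven by the input \<open>\<sigma>\<^sup>i\<close> and with output \<open>h \<sigma>\<^sup>i\<close>. The
  differences \<open>e\<^sub>i = \<chi>\<^sub>i\<^sub>+\<^sub>1 - \<sigma> \<chi>\<^sub>i\<close> form a free trajectory with vanishing output for \<open>n\<close> steps, so
  observability forces \<open>e\<^sub>0 = 0\<close>, that is, \<open>(\<sigma> I - A) \<chi>\<^sub>0 = b\<close>. By controllability this is solvable
  only if \<open>\<sigma> I - A\<close> is invertible, and then \<open>h = c\<^sup>T \<chi>\<^sub>0 = H(\<sigma>)\<close>. The first rank condition provides a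
  solution \<open>(\<xi>, h)\<close>, and the thin SVD makes \<open>G\<close> and its left factor have the same column space.\<close>

section \<open>Iterates of a matrix and linear recurrences\<close>

lemma iterate_mult_carrier:
  assumes "A \<in> carrier_mat n n" "x \<in> carrier_vec n"
  shows "((*\<^sub>v) A ^^ k) x \<in> carrier_vec n"
  using assms by (induction k) auto

text \<open>Moves the iterates from the state to the output functional, so that a linear relation
  between functionals can be evaluated at any state.\<close>

lemma scalar_prod_iterate_transpose:
  fixes A :: "'a :: comm_semiring_0 mat"
  assumes A: "A \<in> carrier_mat n n" and c: "c \<in> carrier_vec n" and x: "x \<in> carrier_vec n"
  shows "c \<bullet> ((*\<^sub>v) A ^^ k) x = ((*\<^sub>v) A\<^sup>T ^^ k) c \<bullet> x"
  using c
proof (induction k arbitrary: c)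
  case (Suc k)
  have "c \<bullet> ((*\<^sub>v) A ^^ Suc k) x = (A\<^sup>T *\<^sub>v c) \<bullet> ((*\<^sub>v) A ^^ k) x"
    using transpose_vec_mult_scalar[OF A iterate_mult_carrier[OF A x] Suc.prems] by simp
  also have "\<dots> = ((*\<^sub>v) A\<^sup>T ^^ k) (A\<^sup>T *\<^sub>v c) \<bullet> x"
    using A Suc by simp
  finally show ?case
    by (simp add: funpow_swap1)
qed simp

text \<open>Taken as columns and padded with a zero row, the \<open>n + 1\<close> vectors form a
  singular square matrix, and a kernel vector supplies the weights \<open>v\<close>. The relation is
  phrased through scalar products because the vectors serve as functionals on states.\<close>

lemma dependent_vec_sequence:
  fixes r :: "nat \<Rightarrow> 'a :: field vec"
  assumes "\<And>k. r k \<in> carrier_vec n"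
  obtains v m where "m \<le> n" "v m \<noteq> 0"
    "\<And>y. y \<in> carrier_vec n \<Longrightarrow> (\<Sum>k\<le>n. v k * (r k \<bullet> y)) = 0"
proof -
  define M where "M = mat (n + 1) (n + 1) (\<lambda>(j, k). if j < n then r k $ j else 0)"
  have M: "M \<in> carrier_mat (n + 1) (n + 1)"
    by (simp add: M_def)
  \<comment> \<open>Row \<open>n\<close> of \<open>M\<close> is the zero padding, so the transpose
    annihilates the last unit vector and the determinant vanishes.\<close>
  have "M\<^sup>T *\<^sub>v unit_vec (n + 1) n = 0\<^sub>v (n + 1)"
    by (intro eq_vecI) (auto simp: M_def scalar_prod_def unit_vec_def intro!: sum.neutral)
  moreover have "(unit_vec (n + 1) n :: 'a vec) \<noteq> 0\<^sub>v (n + 1)"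
    by (metis index_unit_vec(2) index_zero_vec(1) less_add_one zero_neq_one)
  ultimately have "det M\<^sup>T = 0"
    using det_0_iff_vec_prod_zero_field[of "M\<^sup>T" "n + 1"] M transpose_carrier_mat unit_vec_carrier
    by blast
  then have "det M = 0"
    using det_transpose[OF M] by simp
  then obtain w where w: "w \<in> carrier_vec (n + 1)" "w \<noteq> 0\<^sub>v (n + 1)" and Mw: "M *\<^sub>v w = 0\<^sub>v (n + 1)"
    using det_0_iff_vec_prod_zero_field[OF M] by auto
  obtain m where m: "m \<le> n" "w $ m \<noteq> 0"
    using w by (metis Suc_eq_plus1 carrier_vecD eq_vecI index_zero_vec less_Suc_eq_le)
  have coord: "(\<Sum>k\<le>n. w $ k * r k $ j) = 0" if "j < n" for j
  proof -
    have "(M *\<^sub>v w) $ j = (\<Sum>k\<le>n. r k $ j * w $ k)"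
      using that w
      by (auto simp: M_def scalar_prod_def atLeast0LessThan lessThan_Suc_atMost intro!: sum.cong)
    then show ?thesis
      using that Mw by (simp add: mult.commute)
  qed
  have "(\<Sum>k\<le>n. w $ k * (r k \<bullet> y)) = 0" if y: "y \<in> carrier_vec n" for y
  proof -
    have "(\<Sum>k\<le>n. w $ k * (r k \<bullet> y)) = (\<Sum>k\<le>n. \<Sum>j<n. w $ k * r k $ j * y $ j)"
      using y by (simp add: scalar_prod_def sum_distrib_left atLeast0LessThan mult.assoc)
    also have "\<dots> = (\<Sum>j<n. (\<Sum>k\<le>n. w $ k * r k $ j) * y $ j)"
      by (subst sum.swap) (simp add: sum_distrib_right)
    finally show ?thesis
      by (simp add: coord)
  qed
  with m show thesis
    by (rule that)
qed

text \<open>A substitute for the Cayley--Hamilton theorem: \<open>n + 1\<close> functionals on an \<open>n\<close>-dimensional space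
  are dependent, which gives a linear recurrence for the outputs of the free system.\<close>

lemma krylov_functional_vanishes:
  fixes A :: "'a :: field mat"
  assumes A: "A \<in> carrier_mat n n" and c: "c \<in> carrier_vec n" and x: "x \<in> carrier_vec n"
    and init: "\<And>k. k < n \<Longrightarrow> c \<bullet> ((*\<^sub>v) A ^^ k) x = 0"
  shows "c \<bullet> ((*\<^sub>v) A ^^ k) x = 0"
proof -
  define a where "a k = c \<bullet> ((*\<^sub>v) A ^^ k) x" for k
  have rows: "((*\<^sub>v) A\<^sup>T ^^ k) c \<in> carrier_vec n" for k
    using A c by (intro iterate_mult_carrier) auto
  obtain v m0 where m0: "m0 \<le> n" "v m0 \<noteq> 0"
    and v: "\<And>y. y \<in> carrier_vec n \<Longrightarrow> (\<Sum>k\<le>n. v k * (((*\<^sub>v) A\<^sup>T ^^ k) c \<bullet> y)) = 0"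
    using rows by (rule dependent_vec_sequence[where r = "\<lambda>k. ((*\<^sub>v) A\<^sup>T ^^ k) c"]) blast
  have rec: "(\<Sum>k\<le>n. v k * a (k + i)) = 0" for i
    using v[OF iterate_mult_carrier[OF A x, of i]]
    by (simp add: a_def funpow_add scalar_prod_iterate_transpose[OF A c iterate_mult_carrier[OF A x], symmetric])
  \<comment> \<open>The highest index with nonzero coefficient: solving the relation for its leading
    term expresses \<open>a k\<close>, for \<open>k \<ge> m\<close>, by the \<open>m\<close>
    preceding values. As \<open>m \<le> n\<close>, the assumed zeros start the recurrence.\<close>
  define m where "m = Max {k. k \<le> n \<and> v k \<noteq> 0}"
  have fin: "finite {k. k \<le> n \<and> v k \<noteq> 0}"
    by simp
  have m: "m \<le> n" "v m \<noteq> 0"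
    using Max_in[OF fin] m0 unfolding m_def by blast+
  have v0: "v k = 0" if "m < k" "k \<le> n" for k
    using Max_ge[OF fin, of k] that leD unfolding m_def by blast
  have "a k = 0"
  proof (induction k rule: less_induct)
    case (less k)
    show ?case
    proof (cases "k < m")
      case True
      then show ?thesis
        using init m by (simp add: a_def)
    next
      case False
      \<comment> \<open>Terms with \<open>j < m\<close> vanish by induction, those with
        \<open>j > m\<close> by the choice of \<open>m\<close>; what remains is
        \<open>v m * a k\<close>.\<close>
      have "(\<Sum>j\<le>n. v j * a (j + (k - m))) = (\<Sum>j\<in>{m}. v j * a (j + (k - m)))"
      proof (rule sum.mono_neutral_right)
        show "\<forall>j\<in>{..n} - {m}. v j * a (j + (k - m)) = 0"
        proof
          fix j assume "j \<in> {..n} - {m}"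
          then consider "j < m" | "m < j" "j \<le> n"
            by fastforce
          then show "v j * a (j + (k - m)) = 0"
            using less.IH[of "j + (k - m)"] False v0 by cases auto
        qed
      qed (use m in auto)
      then show ?thesis
        using rec[of "k - m"] m False by simp
    qed
  qed
  then show ?thesis
    by (simp add: a_def)
qed

section \<open>Augmented matrices and solvability by rank\<close>

lemma append_col_carrier:
  assumes "M \<in> carrier_mat nr nc" "v \<in> carrier_vec nr"
  shows "append_col M v \<in> carrier_mat nr (nc + 1)"
  using assms by (intro carrier_matI) (auto simp: append_col_def)

lemma index_append_col:
  assumes "M \<in> carrier_mat nr nc" "v \<in> carrier_vec nr" "i < nr" "j < nc + 1"
  shows "append_col M v $$ (i, j) = (if j < nc then M $$ (i, j) else v $ i)"
  using assms by (auto simp: append_col_def mat_of_cols_index nth_append less_Suc_eq)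

text \<open>The solvability half of the Rouche-Capelli theorem. A maximal independent set
  \<open>B\<close> of columns of \<open>M\<close> has \<open>rank M\<close> elements; if
  \<open>v\<close> were outside its span, adjoining \<open>v\<close> would give
  \<open>rank M + 1\<close> independent columns of the augmented matrix.\<close>

lemma (in vec_space) mult_mat_vec_of_rank_append_col_eq:
  assumes M: "M \<in> carrier_mat n nc" and v: "v \<in> carrier_vec n"
    and eq: "rank (append_col M v) = rank M"
  obtains x where "x \<in> carrier_vec nc" "M *\<^sub>v x = v"
proof -
  have Mv: "append_col M v \<in> carrier_mat n (nc + 1)"
    by (rule append_col_carrier[OF M v])
  have cols_Mv: "set (cols (append_col M v)) = insert v (set (cols M))"
    using M v cols_dim[of M] by (simp add: append_col_def)
  obtain B where B: "finite B" "maximal B (\<lambda>T. T \<subseteq> set (cols M) \<and> lin_indpt T)"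
    using maximal_exists_superset[of "set (cols M)" "\<lambda>T. T \<subseteq> set (cols M) \<and> lin_indpt T" "{}"]
    by (auto simp: lin_dep_def)
  then have B_cols: "B \<subseteq> set (cols M)" and "lin_indpt B"
    by (auto simp: maximal_def)
  then have B_carrier: "B \<subseteq> carrier_vec n"
    using cols_dim M by blast
  have "v \<in> span B"
  proof (rule ccontr)
    assume v_notin: "v \<notin> span B"
    then have "v \<notin> B"
      using span_mem B_carrier by auto
    moreover have "lin_indpt (insert v B)"
      using lin_dep_iff_in_span[of B v] B_carrier \<open>lin_indpt B\<close> v v_notin \<open>v \<notin> B\<close> by auto
    ultimately have "card B + 1 \<le> rank (append_col M v)"
      using rank_ge_card_indpt[OF Mv, of "insert v B"] B_cols B(1) cols_Mv by auto
    then show False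
      using rank_card_indpt[OF M B(2)] eq by simp
  qed
  then have "v \<in> col_space M"
    using span_is_monotone[OF B_cols] by (auto simp: col_space_def)
  then show thesis
    using that M unfolding col_space_eq[OF M] by blast
qed

lemma append_col_mult_vec:
  fixes M :: "'a :: comm_semiring_0 mat"
  assumes M: "M \<in> carrier_mat nr nc" and v: "v \<in> carrier_vec nr" and x: "x \<in> carrier_vec (nc + 1)"
  shows "append_col M v *\<^sub>v x = M *\<^sub>v vec_first x nc + x $ nc \<cdot>\<^sub>v v"
proof (rule eq_vecI)
  fix i assume "i < dim_vec (M *\<^sub>v vec_first x nc + x $ nc \<cdot>\<^sub>v v)"
  then have i: "i < nr"
    using v by simp
  note MN = append_col_carrier[OF M v]
  have "(append_col M v *\<^sub>v x) $ i = (\<Sum>j<Suc nc. append_col M v $$ (i, j) * x $ j)"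
    using MN x i by (simp add: scalar_prod_def atLeast0LessThan)
  also have "\<dots> = (\<Sum>j<nc. M $$ (i, j) * x $ j) + v $ i * x $ nc"
    by (simp add: index_append_col[OF M v i])
  also have "\<dots> = (M *\<^sub>v vec_first x nc + x $ nc \<cdot>\<^sub>v v) $ i"
    using M v i by (simp add: scalar_prod_def atLeast0LessThan vec_first_def mult.commute)
  finally show "(append_col M v *\<^sub>v x) $ i = (M *\<^sub>v vec_first x nc + x $ nc \<cdot>\<^sub>v v) $ i" .
qed (use append_col_carrier[OF M v] v in simp)


section \<open>Real matrices acting on complex vectors\<close>

abbreviation complex_vec :: "real vec \<Rightarrow> complex vec" where
  "complex_vec \<equiv> map_vec complex_of_real"

abbreviation complex_mat :: "real mat \<Rightarrow> complex mat" where
  "complex_mat \<equiv> map_mat complex_of_real"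

text \<open>Real factors pass through a real-linear map. An arbitrary such \<open>f\<close> is
  allowed so that \<open>Re\<close> and \<open>Im\<close> are covered at once.\<close>

lemma linear_scalar_prod_complex_vec:
  fixes f :: "complex \<Rightarrow> real"
  assumes f: "linear f" and "dim_vec c = dim_vec z"
  shows "f (complex_vec c \<bullet> z) = c \<bullet> map_vec f z"
proof -
  have scale: "f (complex_of_real r * y) = r * f y" for r y
    using linear_scale[OF f, of r y] by (simp add: scaleR_conv_of_real)
  show ?thesis
    using assms(2) by (simp add: scalar_prod_def linear_sum[OF f] scale)
qed

lemma linear_iterate_complex_mat:
  fixes f :: "complex \<Rightarrow> real"
  assumes f: "linear f" and A: "A \<in> carrier_mat n n" and z: "z \<in> carrier_vec n"
  shows "map_vec f (((*\<^sub>v) (complex_mat A) ^^ k) z) = ((*\<^sub>v) A ^^ k) (map_vec f z)"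
proof (induction k)
  case (Suc k)
  have step: "map_vec f (complex_mat A *\<^sub>v w) = A *\<^sub>v map_vec f w" if "w \<in> carrier_vec n" for w
  proof (rule eq_vecI)
    fix i assume "i < dim_vec (A *\<^sub>v map_vec f w)"
    then have i: "i < n"
      using A by simp
    then have "row (complex_mat A) i = complex_vec (row A i)"
      using A by (intro eq_vecI) auto
    then show "map_vec f (complex_mat A *\<^sub>v w) $ i = (A *\<^sub>v map_vec f w) $ i"
      using A i that by (simp add: linear_scalar_prod_complex_vec[OF f])
  qed (use A in simp)
  have "((*\<^sub>v) (complex_mat A) ^^ k) z \<in> carrier_vec n"
    using A z by (intro iterate_mult_carrier) auto
  then show ?case
    using step Suc by simp
qed simp

section \<open>State trajectories and observability\<close>

lemma state_carrier:
  assumes "A \<in> carrier_mat n n" "b \<in> carrier_vec n" "x0 \<in> carrier_vec n"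
  shows "state A b u x0 k \<in> carrier_vec n"
  using assms by (induction k) auto

text \<open>Observability speaks of an unspecified horizon \<open>N\<close>.
  \<open>krylov_functional_vanishes\<close> extends the \<open>n\<close> zero outputs to all times,
  so under zero input \<open>x\<close> cannot be told from the zero state on any horizon.\<close>

lemma observable_zero:
  assumes A: "A \<in> carrier_mat n n" and b: "b \<in> carrier_vec n" and c: "c \<in> carrier_vec n"
    and obs: "observable n A b c" and x: "x \<in> carrier_vec n"
    and zero: "\<And>k. k < n \<Longrightarrow> c \<bullet> ((*\<^sub>v) A ^^ k) x = 0"
  shows "x = 0\<^sub>v n"
proof -
  have free: "state A b (\<lambda>_. 0) y k = ((*\<^sub>v) A ^^ k) y" if y: "y \<in> carrier_vec n" for y k
  proof (induction k)
    case (Suc k)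
    have "0 \<cdot>\<^sub>v b = 0\<^sub>v n"
      using b by auto
    moreover have "A *\<^sub>v ((*\<^sub>v) A ^^ k) y \<in> carrier_vec n"
      using A iterate_mult_carrier[OF A y, of k] by auto
    ultimately show ?case
      using Suc by simp
  qed simp
  have "((*\<^sub>v) A ^^ k) (0\<^sub>v n) = 0\<^sub>v n" for k
    using A by (induction k) auto
  then have "\<forall>k<N. sys_output A b c (\<lambda>_. 0) x k = sys_output A b c (\<lambda>_. 0) (0\<^sub>v n) k" for N
    using krylov_functional_vanishes[OF A c x zero] c x by (simp add: sys_output_def free)
  then show ?thesis
    using obs x zero_carrier_vec[of n] unfolding observable_def by metis
qed

text \<open>Observability concerns real states. Since \<open>A\<close> and \<open>c\<close> are
  real, the real and imaginary parts of \<open>z\<close> each have vanishing outputs, and each is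
  zero by the real case.\<close>

lemma observable_zero_complex:
  assumes A: "A \<in> carrier_mat n n" and b: "b \<in> carrier_vec n" and c: "c \<in> carrier_vec n"
    and obs: "observable n A b c" and z: "z \<in> carrier_vec n"
    and zero: "\<And>k. k < n \<Longrightarrow> complex_vec c \<bullet> ((*\<^sub>v) (complex_mat A) ^^ k) z = 0"
  shows "z = 0\<^sub>v n"
proof -
  have part: "map_vec f z = 0\<^sub>v n" if f: "linear f" for f :: "complex \<Rightarrow> real"
  proof (rule observable_zero[OF A b c obs])
    fix k assume "k < n"
    have "((*\<^sub>v) (complex_mat A) ^^ k) z \<in> carrier_vec n"
      using A z by (intro iterate_mult_carrier) auto
    then have "f (complex_vec c \<bullet> ((*\<^sub>v) (complex_mat A) ^^ k) z) = c \<bullet> ((*\<^sub>v) A ^^ k) (map_vec f z)"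
      using c by (simp add: linear_scalar_prod_complex_vec[OF f] linear_iterate_complex_mat[OF f A z])
    then show "c \<bullet> ((*\<^sub>v) A ^^ k) (map_vec f z) = 0"
      using zero[OF \<open>k < n\<close>] linear_0[OF f] by simp
  qed (use z in simp)
  have "linear Re" "linear Im"
    by (simp_all add: bounded_linear_Re bounded_linear_Im bounded_linear.linear)
  note parts = part[OF this(1)] part[OF this(2)]
  show ?thesis
  proof (rule eq_vecI)
    fix i assume "i < dim_vec (0\<^sub>v n :: complex vec)"
    then show "z $ i = 0\<^sub>v n $ i"
      using z arg_cong[OF parts(1), of "\<lambda>w. w $ i"] arg_cong[OF parts(2), of "\<lambda>w. w $ i"]
      by (simp add: complex_eq_iff)
  qed (use z in simp)
qed

section \<open>The characteristic matrix and the transfer function\<close>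

lemma zI_minus_carrier:
  assumes "A \<in> carrier_mat n n"
  shows "zI_minus A z \<in> carrier_mat n n"
  using assms by (intro carrier_matI) (auto simp: zI_minus_def)

lemma zI_minus_mult_vec:
  assumes A: "A \<in> carrier_mat n n" and x: "x \<in> carrier_vec n"
  shows "zI_minus A z *\<^sub>v x = z \<cdot>\<^sub>v x - complex_mat A *\<^sub>v x"
proof -
  have "zI_minus A z *\<^sub>v x = (z \<cdot>\<^sub>m 1\<^sub>m n) *\<^sub>v x - complex_mat A *\<^sub>v x"
    using A x by (simp add: zI_minus_def minus_mult_distrib_mat_vec[of _ n n])
  moreover have "(z \<cdot>\<^sub>m 1\<^sub>m n) *\<^sub>v x = z \<cdot>\<^sub>v x"
    using x by (intro eq_vecI) (auto simp: row_smult)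
  ultimately show ?thesis
    by simp
qed

lemma zI_minus_mult_eq_input:
  assumes min: "minimal_system n A b c"
    and \<chi>: "\<And>i. \<chi> i \<in> carrier_vec n"
    and rec: "\<And>i. i \<le> n \<Longrightarrow> \<chi> (Suc i) = complex_mat A *\<^sub>v \<chi> i + \<sigma> ^ i \<cdot>\<^sub>v complex_vec b"
    and out: "\<And>i. i \<le> n \<Longrightarrow> complex_vec c \<bullet> \<chi> i = m * \<sigma> ^ i"
  shows "zI_minus A \<sigma> *\<^sub>v \<chi> 0 = complex_vec b"
proof -
  have A: "A \<in> carrier_mat n n" and b: "b \<in> carrier_vec n" and c: "c \<in> carrier_vec n"
    and obs: "observable n A b c"
    using min by (auto simp: minimal_system_def)
  have A': "complex_mat A \<in> carrier_mat n n" and b': "complex_vec b \<in> carrier_vec n"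
    and c': "complex_vec c \<in> carrier_vec n"
    using A b c by auto
  \<comment> \<open>Shifting in time and multiplying by \<sigma> agree on the input
    \<open>\<sigma> ^ i\<close> and on the output \<open>m * \<sigma> ^ i\<close>, so both cancel in
    \<open>e\<close>.\<close>
  define e where "e i = \<chi> (Suc i) - \<sigma> \<cdot>\<^sub>v \<chi> i" for i
  have e: "e i \<in> carrier_vec n" for i
    using \<chi> by (simp add: e_def)
  have e_Suc: "e (Suc i) = complex_mat A *\<^sub>v e i" if "i < n" for i
  proof -
    have "complex_mat A *\<^sub>v e i = complex_mat A *\<^sub>v \<chi> (Suc i) - \<sigma> \<cdot>\<^sub>v (complex_mat A *\<^sub>v \<chi> i)"
      using A' \<chi> by (simp add: e_def mult_minus_distrib_mat_vec[of _ n n] mult_mat_vec[of _ n n])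
    moreover have "e (Suc i) = (complex_mat A *\<^sub>v \<chi> (Suc i) + \<sigma> ^ Suc i \<cdot>\<^sub>v complex_vec b)
        - \<sigma> \<cdot>\<^sub>v (complex_mat A *\<^sub>v \<chi> i + \<sigma> ^ i \<cdot>\<^sub>v complex_vec b)"
      using that rec[of "Suc i"] rec[of i] by (simp add: e_def)
    moreover have "(p + \<sigma> ^ Suc i \<cdot>\<^sub>v complex_vec b) - \<sigma> \<cdot>\<^sub>v (q + \<sigma> ^ i \<cdot>\<^sub>v complex_vec b) = p - \<sigma> \<cdot>\<^sub>v q"
      if "p \<in> carrier_vec n" "q \<in> carrier_vec n" for p q
      using that b by (intro eq_vecI) (auto simp: algebra_simps)
    ultimately show ?thesis
      using A' \<chi> by simp
  qed
  have e_iter: "e i = ((*\<^sub>v) (complex_mat A) ^^ i) (e 0)" if "i \<le> n" for i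
    using that by (induction i) (auto simp: e_Suc)
  \<comment> \<open>The outputs of \<open>e 0, ..., e (n - 1)\<close> use \<open>out\<close> at
    times 0 to \<open>n\<close>. These \<open>n + 1\<close> equations are what a Hankel matrix of
    depth \<open>n\<close> provides, and they yield the \<open>n\<close> zeros that observability
    asks for.\<close>
  have "e 0 = 0\<^sub>v n"
  proof (rule observable_zero_complex[OF A b c obs e])
    fix k assume k: "k < n"
    have "complex_vec c \<bullet> e k = complex_vec c \<bullet> \<chi> (Suc k) - \<sigma> * (complex_vec c \<bullet> \<chi> k)"
      using c' \<chi> by (simp add: e_def scalar_prod_minus_distrib[of _ n])
    also have "\<dots> = 0"
      using k by (simp add: out)
    finally show "complex_vec c \<bullet> ((*\<^sub>v) (complex_mat A) ^^ k) (e 0) = 0"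
      using e_iter[of k] k by simp
  qed
  then have "complex_mat A *\<^sub>v \<chi> 0 + complex_vec b - \<sigma> \<cdot>\<^sub>v \<chi> 0 = 0\<^sub>v n"
    using rec[of 0] b' by (simp add: e_def)
  moreover have "\<sigma> \<cdot>\<^sub>v s - p = q" if "p + q - \<sigma> \<cdot>\<^sub>v s = 0\<^sub>v n"
    "p \<in> carrier_vec n" "q \<in> carrier_vec n" "s \<in> carrier_vec n" for p q s :: "complex vec"
  proof (rule eq_vecI)
    fix i assume "i < dim_vec q"
    then show "(\<sigma> \<cdot>\<^sub>v s - p) $ i = q $ i"
      using arg_cong[OF that(1), of "\<lambda>w. w $ i"] that(2-) by (simp add: algebra_simps)
  qed (use that in simp)
  ultimately show ?thesis
    using A' b' \<chi> by (simp add: zI_minus_mult_vec[OF A])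
qed

text \<open>The Popov--Belevitch--Hautus argument: a left eigenvector annihilating \<open>b\<close>
  annihilates every state reachable from the origin.\<close>

lemma det_zI_minus_nonzero:
  assumes A: "A \<in> carrier_mat n n" and b: "b \<in> carrier_vec n" and ctrl: "controllable n A b"
    and w: "w \<in> carrier_vec n" "zI_minus A \<sigma> *\<^sub>v w = complex_vec b"
  shows "det (zI_minus A \<sigma>) \<noteq> 0"
proof
  assume "det (zI_minus A \<sigma>) = 0"
  moreover note Z = zI_minus_carrier[OF A, of \<sigma>]
  ultimately obtain v where v: "v \<in> carrier_vec n" "v \<noteq> 0\<^sub>v n" "(zI_minus A \<sigma>)\<^sup>T *\<^sub>v v = 0\<^sub>v n"
    using det_0_iff_vec_prod_zero_field[of "(zI_minus A \<sigma>)\<^sup>T" n] det_transpose[OF Z] by auto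
  have A': "complex_mat A \<in> carrier_mat n n"
    using A by simp
  have left: "v \<bullet> (zI_minus A \<sigma> *\<^sub>v y) = 0" if "y \<in> carrier_vec n" for y
    using transpose_vec_mult_scalar[OF Z that v(1)] v(3) that by simp
  \<comment> \<open>Solvability for \<open>w\<close> enters here: \<open>v\<close> annihilates the
    range of \<open>zI_minus A \<sigma>\<close>, which contains the input vector.\<close>
  have vb: "v \<bullet> complex_vec b = 0"
    using left[OF w(1)] w(2) by simp
  have eig: "v \<bullet> (complex_mat A *\<^sub>v y) = \<sigma> * (v \<bullet> y)" if y: "y \<in> carrier_vec n" for y
    using left[OF y] y A' v(1) by (simp add: zI_minus_mult_vec[OF A y] scalar_prod_minus_distrib[of _ n])
  have reach: "v \<bullet> complex_vec (state A b u (0\<^sub>v n) k) = 0" for u k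
  proof (induction k)
    case 0
    then show ?case
      using v(1) by (simp add: of_real_hom.vec_hom_zero)
  next
    case (Suc k)
    let ?x = "state A b u (0\<^sub>v n) k"
    have x: "?x \<in> carrier_vec n"
      using state_carrier[OF A b] by simp
    have "complex_vec (A *\<^sub>v ?x + u k \<cdot>\<^sub>v b)
        = complex_mat A *\<^sub>v complex_vec ?x + complex_of_real (u k) \<cdot>\<^sub>v complex_vec b"
      using A b x
      by (subst of_real_hom.mult_mat_vec_hom[OF A x, symmetric]) (auto intro!: eq_vecI)
    then show ?case
      using Suc eig[of "complex_vec ?x"] A' b v(1) x
      by (simp add: scalar_prod_add_distrib[of _ n] vb)
  qed
  \<comment> \<open>Reachable states are real while \<open>v\<close> is complex, but the real unit
    vectors already read off its coordinates.\<close>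
  have "v $ i = 0" if i: "i < n" for i
  proof -
    obtain u N where "state A b u (0\<^sub>v n) N = unit_vec n i"
      using ctrl unfolding controllable_def by (meson unit_vec_carrier zero_carrier_vec)
    then have "v \<bullet> complex_vec (unit_vec n i) = 0"
      using reach[of u N] by simp
    moreover have "complex_vec (unit_vec n i) = unit_vec n i"
      using i by (intro eq_vecI) (auto simp: unit_vec_def)
    ultimately show ?thesis
      using i v(1) by simp
  qed
  then show False
    using v by (metis carrier_vecD eq_vecI index_zero_vec)
qed

text \<open>A nonzero determinant makes \<open>mat_inverse\<close> return a genuine inverse, so the
  unspecified value in \<open>transfer_fun\<close> does not arise; that inverse sends the input
  vector to \<open>w\<close>.\<close>

lemma transfer_fun_eqI:
  assumes A: "A \<in> carrier_mat n n" and det: "det (zI_minus A \<sigma>) \<noteq> 0"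
    and w: "w \<in> carrier_vec n" "zI_minus A \<sigma> *\<^sub>v w = complex_vec b"
  shows "invertible_mat (zI_minus A \<sigma>)" "transfer_fun A b c \<sigma> = complex_vec c \<bullet> w"
proof -
  note Z = zI_minus_carrier[OF A, of \<sigma>]
  obtain B where B: "mat_inverse (zI_minus A \<sigma>) = Some B"
    using mat_inverse(1)[OF Z] det_non_zero_imp_unit[OF Z det] by fastforce
  note inv = mat_inverse(2)[OF Z B]
  show "invertible_mat (zI_minus A \<sigma>)"
    using inv Z by (auto simp: invertible_mat_def inverts_mat_def)
  have "B *\<^sub>v complex_vec b = (B * zI_minus A \<sigma>) *\<^sub>v w"
    unfolding w(2)[symmetric] using inv Z w(1) by (intro assoc_mult_mat_vec[symmetric]) auto
  then show "transfer_fun A b c \<sigma> = complex_vec c \<bullet> w"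
    using inv w B by (simp add: transfer_fun_def)
qed

section \<open>Hankel matrices and weighted trajectories\<close>

lemma linear_comb_scalar_prod:
  fixes a :: "'a :: comm_semiring_0 vec"
  assumes "a \<in> carrier_vec n" "\<And>j. j < N \<Longrightarrow> f j \<in> carrier_vec n"
  shows "a \<bullet> vec n (\<lambda>r. \<Sum>j<N. \<xi> j * f j $ r) = (\<Sum>j<N. \<xi> j * (a \<bullet> f j))"
proof -
  have "a \<bullet> vec n (\<lambda>r. \<Sum>j<N. \<xi> j * f j $ r) = (\<Sum>r<n. \<Sum>j<N. \<xi> j * (a $ r * f j $ r))"
    by (simp add: scalar_prod_def atLeast0LessThan sum_distrib_left mult.left_commute)
  also have "\<dots> = (\<Sum>j<N. \<xi> j * (a \<bullet> f j))"
    by (subst sum.swap)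
      (auto simp: scalar_prod_def atLeast0LessThan sum_distrib_left carrier_vecD[OF assms(2)] intro!: sum.cong)
  finally show ?thesis .
qed

text \<open>The column count \<open>T + 1 - n\<close> of the definition equals
  \<open>T - n + 1\<close> under truncated subtraction because \<open>n \<le> T\<close>.\<close>

lemma hankel_carrier:
  assumes "w \<in> carrier_vec (T + 1)" "n \<le> T"
  shows "hankel n w \<in> carrier_mat (n + 1) (T - n + 1)"
  using assms by (simp add: hankel_def Suc_diff_le)

lemma index_hankel_mult_vec:
  assumes w: "w \<in> carrier_vec (T + 1)" and "n \<le> T" and \<xi>: "\<xi> \<in> carrier_vec (T - n + 1)" and i: "i \<le> n"
  shows "(complex_mat (hankel n w) *\<^sub>v \<xi>) $ i = (\<Sum>j<T - n + 1. \<xi> $ j * complex_of_real (w $ (i + j)))"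
  using assms
  by (auto simp: hankel_def scalar_prod_def atLeast0LessThan Suc_diff_le mult.commute intro!: sum.cong)

text \<open>Column \<open>j\<close> of each Hankel matrix is a window of the data starting at time
  \<open>j\<close>. By linearity and time invariance the \<xi>-combination of these windows is again
  an input/output pair of the system, here \<open>\<sigma> ^ i\<close> and
  \<open>h * \<sigma> ^ i\<close> for \<open>i \<le> n\<close>.\<close>

lemma hankel_solution_imp_transfer_fun:
  assumes min: "minimal_system n A b c" and T: "n \<le> T"
    and U: "U \<in> carrier_vec (T + 1)" and Y: "Y \<in> carrier_vec (T + 1)"
    and data: "io_data n A b c U Y" and \<xi>: "\<xi> \<in> carrier_vec (T - n + 1)"
    and HU: "complex_mat (hankel n U) *\<^sub>v \<xi> = gamma_vec n \<sigma>"
    and HY: "complex_mat (hankel n Y) *\<^sub>v \<xi> = h \<cdot>\<^sub>v gamma_vec n \<sigma>"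
  shows "invertible_mat (zI_minus A \<sigma>)" "h = transfer_fun A b c \<sigma>"
proof -
  have A: "A \<in> carrier_mat n n" and b: "b \<in> carrier_vec n" and c: "c \<in> carrier_vec n"
    and ctrl: "controllable n A b"
    using min by (auto simp: minimal_system_def)
  obtain x0 where x0: "x0 \<in> carrier_vec n"
    and Y_eq: "\<And>k. k < T + 1 \<Longrightarrow> Y $ k = c \<bullet> state A b (\<lambda>i. U $ i) x0 k"
    using data U unfolding io_data_def sys_output_def by auto
  define x where "x k = state A b (\<lambda>i. U $ i) x0 k" for k
  have x: "x k \<in> carrier_vec n" for k
    unfolding x_def by (rule state_carrier[OF A b x0])
  define N where "N = T - n + 1"
  \<comment> \<open>For \<open>i = n + 1\<close> the state at time \<open>T + 1\<close> enters; it
    depends on inputs only up to time \<open>T\<close>, all of them data.\<close>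
  define \<chi> where "\<chi> i = vec n (\<lambda>r. \<Sum>j<N. \<xi> $ j * complex_vec (x (i + j)) $ r)" for i
  have input: "(\<Sum>j<N. \<xi> $ j * complex_of_real (U $ (i + j))) = \<sigma> ^ i" if "i \<le> n" for i
    using index_hankel_mult_vec[OF U T \<xi> that] that by (simp add: HU gamma_vec_def N_def)
  have rec: "\<chi> (Suc i) = complex_mat A *\<^sub>v \<chi> i + \<sigma> ^ i \<cdot>\<^sub>v complex_vec b" if i: "i \<le> n" for i
  proof (rule eq_vecI)
    fix r assume "r < dim_vec (complex_mat A *\<^sub>v \<chi> i + \<sigma> ^ i \<cdot>\<^sub>v complex_vec b)"
    then have r: "r < n"
      using b by simp
    have step: "complex_vec (x (Suc i + j)) $ r
        = row (complex_mat A) r \<bullet> complex_vec (x (i + j)) + complex_of_real (U $ (i + j)) * complex_vec b $ r" for j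
    proof -
      have "complex_vec (A *\<^sub>v x (i + j)) $ r = row (complex_mat A) r \<bullet> complex_vec (x (i + j))"
        using A r x by (subst of_real_hom.mult_mat_vec_hom[OF A x]) simp
      then show ?thesis
        using A b r x by (simp add: x_def[of "Suc (i + j)"] x_def[of "i + j", symmetric])
    qed
    have "\<chi> (Suc i) $ r = (\<Sum>j<N. \<xi> $ j * (row (complex_mat A) r \<bullet> complex_vec (x (i + j))))
        + (\<Sum>j<N. \<xi> $ j * complex_of_real (U $ (i + j))) * complex_vec b $ r"
      using r by (simp only: \<chi>_def index_vec step distrib_left sum.distrib sum_distrib_right mult.assoc)
    also have "(\<Sum>j<N. \<xi> $ j * (row (complex_mat A) r \<bullet> complex_vec (x (i + j)))) = row (complex_mat A) r \<bullet> \<chi> i"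
      unfolding \<chi>_def using A x by (intro linear_comb_scalar_prod[symmetric] carrier_vecI) auto
    finally show "\<chi> (Suc i) $ r = (complex_mat A *\<^sub>v \<chi> i + \<sigma> ^ i \<cdot>\<^sub>v complex_vec b) $ r"
      using A b r by (simp add: input[OF i])
  qed (use b in \<open>simp add: \<chi>_def\<close>)
  have out: "complex_vec c \<bullet> \<chi> i = h * \<sigma> ^ i" if i: "i \<le> n" for i
  proof -
    have "complex_vec c \<bullet> \<chi> i = (\<Sum>j<N. \<xi> $ j * (complex_vec c \<bullet> complex_vec (x (i + j))))"
      unfolding \<chi>_def using c x by (intro linear_comb_scalar_prod) auto
    also have "\<dots> = (\<Sum>j<N. \<xi> $ j * complex_of_real (Y $ (i + j)))"
    proof (rule sum.cong)
      fix j assume "j \<in> {..<N}"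
      then have "i + j < T + 1"
        using i T by (auto simp: N_def)
      then show "\<xi> $ j * (complex_vec c \<bullet> complex_vec (x (i + j))) = \<xi> $ j * complex_of_real (Y $ (i + j))"
        using c x[of "i + j"] by (simp add: Y_eq x_def[symmetric] scalar_prod_def)
    qed simp
    also have "\<dots> = h * \<sigma> ^ i"
      using index_hankel_mult_vec[OF Y T \<xi> i] i by (simp add: HY gamma_vec_def N_def)
    finally show ?thesis .
  qed
  have \<chi>: "\<chi> i \<in> carrier_vec n" for i
    by (simp add: \<chi>_def)
  have eq: "zI_minus A \<sigma> *\<^sub>v \<chi> 0 = complex_vec b"
    using zI_minus_mult_eq_input[OF min \<chi> rec out] .
  note H = transfer_fun_eqI[OF A det_zI_minus_nonzero[OF A b ctrl \<chi> eq] \<chi> eq]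
  show "invertible_mat (zI_minus A \<sigma>)"
    by (rule H(1))
  \<comment> \<open>At time 0 the factor \<open>\<sigma> ^ 0\<close> is 1, so \<open>h\<close> is
    the output of the state \<open>\<chi> 0\<close>.\<close>
  show "h = transfer_fun A b c \<sigma>"
    using out[of 0] by (simp add: H(2))
qed

section \<open>The stacked data matrix\<close>

lemma data_mat_carrier:
  assumes "U \<in> carrier_vec (T + 1)" "Y \<in> carrier_vec (T + 1)" "n \<le> T"
  shows "data_mat n U Y \<in> carrier_mat (n + 1 + (n + 1)) (T - n + 1)"
  unfolding data_mat_def using assms by (intro carrier_append_rows hankel_carrier)

lemma data_mat_mult_vec:
  assumes U: "U \<in> carrier_vec (T + 1)" and Y: "Y \<in> carrier_vec (T + 1)" and T: "n \<le> T"
    and \<xi>: "\<xi> \<in> carrier_vec (T - n + 1)"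
  shows "complex_mat (data_mat n U Y) *\<^sub>v \<xi>
    = (complex_mat (hankel n U) *\<^sub>v \<xi>) @\<^sub>v (complex_mat (hankel n Y) *\<^sub>v \<xi>)"
proof -
  have "complex_mat (data_mat n U Y) = complex_mat (hankel n U) @\<^sub>r complex_mat (hankel n Y)"
    using hankel_carrier[OF U T] hankel_carrier[OF Y T]
    by (intro eq_matI) (auto simp: data_mat_def append_rows_def)
  then show ?thesis
    using mat_mult_append[of "complex_mat (hankel n U)" "n + 1" "T - n + 1"
        "complex_mat (hankel n Y)" "n + 1" \<xi>] hankel_carrier[OF U T] hankel_carrier[OF Y T] \<xi>
    by simp
qed

text \<open>The upper block of \<open>z_vec\<close> is zero and the lower one is
  \<open>- gamma_vec n \<sigma>\<close>, so the equation splits into the two Hankel equations, with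
  \<open>h\<close> changing sides in the second.\<close>

lemma data_solution_imp_transfer_fun:
  assumes min: "minimal_system n A b c" and T: "n \<le> T"
    and U: "U \<in> carrier_vec (T + 1)" and Y: "Y \<in> carrier_vec (T + 1)"
    and data: "io_data n A b c U Y" and \<xi>: "\<xi> \<in> carrier_vec (T - n + 1)"
    and eq: "complex_mat (data_mat n U Y) *\<^sub>v \<xi> + h \<cdot>\<^sub>v z_vec n \<sigma> = b_vec n \<sigma>"
  shows "invertible_mat (zI_minus A \<sigma>)" "h = transfer_fun A b c \<sigma>"
proof -
  let ?HU = "complex_mat (hankel n U) *\<^sub>v \<xi>" and ?HY = "complex_mat (hankel n Y) *\<^sub>v \<xi>"
  have dims: "dim_vec ?HU = n + 1" "dim_vec ?HY = n + 1"
    by (simp_all add: hankel_def)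
  have top: "?HU = gamma_vec n \<sigma>"
  proof (rule eq_vecI)
    fix i assume "i < dim_vec (gamma_vec n \<sigma>)"
    then show "?HU $ i = gamma_vec n \<sigma> $ i"
      using arg_cong[OF eq, of "\<lambda>w. w $ i"] dims
      by (simp add: data_mat_mult_vec[OF U Y T \<xi>] z_vec_def b_vec_def gamma_vec_def
          del: index_mult_mat_vec)
  qed (use dims in \<open>simp add: gamma_vec_def\<close>)
  have bot: "?HY = h \<cdot>\<^sub>v gamma_vec n \<sigma>"
  proof (rule eq_vecI)
    fix i assume "i < dim_vec (h \<cdot>\<^sub>v gamma_vec n \<sigma>)"
    then show "?HY $ i = (h \<cdot>\<^sub>v gamma_vec n \<sigma>) $ i"
      using arg_cong[OF eq, of "\<lambda>w. w $ (n + 1 + i)"] dims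
      by (simp add: data_mat_mult_vec[OF U Y T \<xi>] z_vec_def b_vec_def gamma_vec_def
          del: index_mult_mat_vec)
  qed (use dims in \<open>simp add: gamma_vec_def\<close>)
  show "invertible_mat (zI_minus A \<sigma>)" "h = transfer_fun A b c \<sigma>"
    using hankel_solution_imp_transfer_fun[OF min T U Y data \<xi> top bot] by auto
qed

section \<open>Column space of the left singular factor\<close>

text \<open>Since \<open>V\<close> has orthonormal columns, right multiplication by \<open>V\<close>
  and then by the inverse of \<open>S\<close> turns \<open>G\<close> into \<open>W\<close>; the
  factor in the other direction is \<open>S * V\<^sup>T\<close>. Solutions can thus be moved between
  the two matrices.\<close>

lemma thin_svd_factors:
  assumes "thin_svd G p W S V" and G: "G \<in> carrier_mat nr nc"
  obtains K L where "K \<in> carrier_mat nc p" "L \<in> carrier_mat p nc" "W = G * K" "G = W * L"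
proof -
  have W: "W \<in> carrier_mat nr p" and S: "S \<in> carrier_mat p p" and V: "V \<in> carrier_mat nc p"
    and VV: "V\<^sup>T * V = 1\<^sub>m p" and diag: "diagonal_mat S" and pos: "\<And>i. i < p \<Longrightarrow> S $$ (i, i) > 0"
    and G_eq: "G = W * S * V\<^sup>T"
    using assms by (auto simp: thin_svd_def)
  define D where "D = mat p p (\<lambda>(i, j). if i = j then inverse (S $$ (i, i)) else 0)"
  have D: "D \<in> carrier_mat p p"
    by (simp add: D_def)
  have SD: "S * D = 1\<^sub>m p"
  proof (rule eq_matI)
    fix i j assume "i < dim_row (1\<^sub>m p :: real mat)" "j < dim_col (1\<^sub>m p :: real mat)"
    then have ij: "i < p" "j < p"
      by auto
    have "(S * D) $$ (i, j) = (\<Sum>k<p. S $$ (i, k) * D $$ (k, j))"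
      using S D ij by (simp add: scalar_prod_def atLeast0LessThan)
    also have "\<dots> = (\<Sum>k<p. if k = j then S $$ (i, j) * inverse (S $$ (j, j)) else 0)"
      using ij by (intro sum.cong) (auto simp: D_def)
    also have "\<dots> = 1\<^sub>m p $$ (i, j)"
      using ij S diag pos[of j] by (auto simp: diagonal_mat_def)
    finally show "(S * D) $$ (i, j) = 1\<^sub>m p $$ (i, j)" .
  qed (use S D in auto)
  have WS: "W * S \<in> carrier_mat nr p" and Vt: "V\<^sup>T \<in> carrier_mat p nc"
    using W S V by auto
  have "G * (V * D) = W * S * (V\<^sup>T * (V * D))"
    unfolding G_eq using WS Vt V D by (intro assoc_mult_mat) auto
  also have "V\<^sup>T * (V * D) = D"
    using assoc_mult_mat[OF Vt V D] D by (simp add: VV)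
  also have "W * S * D = W"
    using assoc_mult_mat[OF W S D] W by (simp add: SD)
  finally have "W = G * (V * D)"
    by simp
  moreover have "G = W * (S * V\<^sup>T)"
    unfolding G_eq by (rule assoc_mult_mat[OF W S Vt])
  ultimately show thesis
    using that[of "V * D" "S * V\<^sup>T"] V D S Vt by auto
qed

section \<open>Solvability and uniqueness of the last component\<close>

theorem corollary3p2:
  fixes A :: "real mat" and b c U Y :: "real vec" and n T p :: nat and \<sigma> :: complex
    and W S V :: "real mat"
  defines "G \<equiv> map_mat complex_of_real (data_mat n U Y)"
    and "H \<equiv> transfer_fun A b c"
  assumes minimal: "minimal_system n A b c"
    and T: "n \<le> T"
    and U: "U \<in> carrier_vec (T + 1)"
    and Y: "Y \<in> carrier_vec (T + 1)"
    and data: "io_data n A b c U Y"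
    and rank1:
      "mat_rank (append_col (append_col G (0\<^sub>v (n + 1) @\<^sub>v gamma_vec n \<sigma>))
                            (gamma_vec n \<sigma> @\<^sub>v 0\<^sub>v (n + 1)))
       = mat_rank (append_col G (0\<^sub>v (n + 1) @\<^sub>v gamma_vec n \<sigma>))"
    and rank2:
      "mat_rank (append_col G (0\<^sub>v (n + 1) @\<^sub>v gamma_vec n \<sigma>)) = mat_rank G + 1"
    and p: "p \<le> T - n + 1"
    and svd: "thin_svd (data_mat n U Y) p W S V"
  shows "invertible_mat (zI_minus A \<sigma>) \<and>
    (\<exists>\<xi>\<in>carrier_vec (T - n + 1).
       append_col G (z_vec n \<sigma>) *\<^sub>v (\<xi> @\<^sub>v vec_of_list [H \<sigma>]) = b_vec n \<sigma>) \<and>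
    (\<exists>\<xi>'\<in>carrier_vec p.
       append_col (map_mat complex_of_real W) (z_vec n \<sigma>) *\<^sub>v (\<xi>' @\<^sub>v vec_of_list [H \<sigma>])
       = b_vec n \<sigma>) \<and>
    (\<forall>x\<in>carrier_vec (T - n + 2).
       append_col G (z_vec n \<sigma>) *\<^sub>v x = b_vec n \<sigma> \<longrightarrow> x $ (T - n + 1) = H \<sigma>) \<and>
    (\<forall>x'\<in>carrier_vec (p + 1).
       append_col (map_mat complex_of_real W) (z_vec n \<sigma>) *\<^sub>v x' = b_vec n \<sigma> \<longrightarrow> x' $ p = H \<sigma>)"
proof -
  define h where "h = H \<sigma>"
  define N where "N = T - n + 1"
  define m where "m = n + 1 + (n + 1)"
  let ?W = "complex_mat W" and ?z = "z_vec n \<sigma>" and ?b = "b_vec n \<sigma>"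
  have G: "G \<in> carrier_mat m N" and G_real: "data_mat n U Y \<in> carrier_mat m N"
    using data_mat_carrier[OF U Y T] by (auto simp: G_def m_def N_def)
  have z: "?z \<in> carrier_vec m" and b: "?b \<in> carrier_vec m"
    and z': "0\<^sub>v (n + 1) @\<^sub>v gamma_vec n \<sigma> \<in> carrier_vec m"
    by (auto simp: z_vec_def b_vec_def gamma_vec_def m_def intro!: carrier_vecI)
  obtain K L where K: "K \<in> carrier_mat N p" and L: "L \<in> carrier_mat p N"
    and W_eq: "W = data_mat n U Y * K" and G_eq: "data_mat n U Y = W * L"
    by (rule thin_svd_factors[OF svd G_real])
  have W: "W \<in> carrier_mat m p"
    using svd G_real by (auto simp: thin_svd_def)
  then have W': "?W \<in> carrier_mat m p"
    by simp
  \<comment> \<open>Whatever its weights, a solution has last component \<open>h\<close>. One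
    solution therefore gives invertibility and the existence claims, and the uniqueness claims are
    instances as well.\<close>
  have sol: "invertible_mat (zI_minus A \<sigma>) \<and> s = h"
    if "\<xi> \<in> carrier_vec N" "G *\<^sub>v \<xi> + s \<cdot>\<^sub>v ?z = ?b" for \<xi> s
    using data_solution_imp_transfer_fun[OF minimal T U Y data, of \<xi> s \<sigma>] that
    by (auto simp: G_def H_def N_def h_def)
  have W_mult: "?W *\<^sub>v y = G *\<^sub>v (complex_mat K *\<^sub>v y)" if "y \<in> carrier_vec p" for y
    using that G K by (simp add: W_eq G_def of_real_hom.mat_hom_mult[OF G_real K] assoc_mult_mat_vec[of _ m N _ p])
  have G_mult: "G *\<^sub>v y = ?W *\<^sub>v (complex_mat L *\<^sub>v y)" if "y \<in> carrier_vec N" for y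
  proof -
    have "G = ?W * complex_mat L"
      unfolding G_def by (subst G_eq) (rule of_real_hom.mat_hom_mult[OF W L])
    then show ?thesis
      using that W L by (simp add: assoc_mult_mat_vec[of _ m p _ N])
  qed
  have append_mult: "append_col M ?z *\<^sub>v (\<xi> @\<^sub>v vec_of_list [s]) = M *\<^sub>v \<xi> + s \<cdot>\<^sub>v ?z"
    if "M \<in> carrier_mat m k" "\<xi> \<in> carrier_vec k" for M k \<xi> s
  proof -
    have "vec_first (\<xi> @\<^sub>v vec_of_list [s]) k = \<xi>"
      using that by (intro eq_vecI) (auto simp: vec_first_def)
    moreover have "(\<xi> @\<^sub>v vec_of_list [s]) $ k = s"
      using that by simp
    moreover have "\<xi> @\<^sub>v vec_of_list [s] \<in> carrier_vec (k + 1)"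
      using that by (intro carrier_vecI) simp
    ultimately show ?thesis
      using append_col_mult_vec[OF that(1) z] by simp
  qed
  have "vec_space.rank m (append_col (append_col G (0\<^sub>v (n + 1) @\<^sub>v gamma_vec n \<sigma>)) ?b)
      = vec_space.rank m (append_col G (0\<^sub>v (n + 1) @\<^sub>v gamma_vec n \<sigma>))"
    using rank1 G by (simp add: append_col_def b_vec_def)
  then obtain x where x: "x \<in> carrier_vec (N + 1)"
    and x_eq: "append_col G (0\<^sub>v (n + 1) @\<^sub>v gamma_vec n \<sigma>) *\<^sub>v x = ?b"
    by (rule vec_space.mult_mat_vec_of_rank_append_col_eq[OF append_col_carrier[OF G z'] b])
  define \<xi> where "\<xi> = vec_first x N"
  have \<xi>: "\<xi> \<in> carrier_vec N"
    by (simp add: \<xi>_def)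
  \<comment> \<open>The rank condition carries \<open>gamma_vec\<close> with a plus sign and
    \<open>z_vec\<close> with a minus sign, so the value sought is \<open>- (x $ N)\<close>.\<close>
  have "x $ N \<cdot>\<^sub>v (0\<^sub>v (n + 1) @\<^sub>v gamma_vec n \<sigma>) = - (x $ N) \<cdot>\<^sub>v ?z"
    by (intro eq_vecI) (auto simp: z_vec_def gamma_vec_def)
  then have \<xi>_eq: "G *\<^sub>v \<xi> + - (x $ N) \<cdot>\<^sub>v ?z = ?b"
    using x_eq append_col_mult_vec[OF G z' x] by (simp add: \<xi>_def)
  then have inv: "invertible_mat (zI_minus A \<sigma>)" and "- (x $ N) = h"
    using sol[OF \<xi>] by auto
  then have G\<xi>: "G *\<^sub>v \<xi> + h \<cdot>\<^sub>v ?z = ?b"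
    using \<xi>_eq by simp
  have L\<xi>: "complex_mat L *\<^sub>v \<xi> \<in> carrier_vec p"
    using L by (intro carrier_vecI) simp
  have "\<exists>\<xi>\<in>carrier_vec N. append_col G ?z *\<^sub>v (\<xi> @\<^sub>v vec_of_list [h]) = ?b"
    by (intro bexI[OF _ \<xi>]) (simp only: append_mult[OF G \<xi>] G\<xi>)
  \<comment> \<open>\<open>L\<close> carries weights for \<open>G\<close> to weights for
    \<open>W\<close> and leaves the last component unchanged.\<close>
  moreover have "\<exists>\<xi>'\<in>carrier_vec p. append_col ?W ?z *\<^sub>v (\<xi>' @\<^sub>v vec_of_list [h]) = ?b"
    by (intro bexI[OF _ L\<xi>]) (simp only: append_mult[OF W' L\<xi>] G_mult[OF \<xi>, symmetric] G\<xi>)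
  moreover have "x $ N = h" if "x \<in> carrier_vec (N + 1)" "append_col G ?z *\<^sub>v x = ?b" for x
    using sol[of "vec_first x N" "x $ N"] append_col_mult_vec[OF G z that(1)] that(2) by simp
  moreover have "x $ p = h" if x: "x \<in> carrier_vec (p + 1)" "append_col ?W ?z *\<^sub>v x = ?b" for x
  proof -
    \<comment> \<open>\<open>K\<close> carries a solution for \<open>W\<close> back to one for
      \<open>G\<close> with the same last component, to which \<open>sol\<close> applies.\<close>
    have "complex_mat K *\<^sub>v vec_first x p \<in> carrier_vec N"
      using K by (intro carrier_vecI) simp
    moreover have "G *\<^sub>v (complex_mat K *\<^sub>v vec_first x p) + x $ p \<cdot>\<^sub>v ?z = ?b"
      using append_col_mult_vec[OF W' z x(1)] x(2) by (simp add: W_mult)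
    ultimately show ?thesis
      using sol by blast
  qed
  ultimately show ?thesis
    using inv unfolding h_def N_def by (simp add: add.assoc)
qed

end
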